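(* If two $M_t$-dimensional subspaces $\Pi_1, \Pi_2$ of $GF(q)^m$ are nonintersecting (i.e. $\Pi_1 \cap \Pi_2 = \{0\}$), then their lifts $\bar{\Pi}_1, \bar{\Pi}_2 \subseteq \mathbb{C}^m$ are also nonintersecting over $\mathbb{C}$.
   Context: Let $q = p^k$ with $p$ prime, and write $GF(q) = GF(p)[\alpha]$, where $\alpha$ is a root of a primitive irreducible polynomial $f(X) \in GF(p)[X]$. Let $n = q-1$ and $\mu_n = e^{2\pi i/n}$. In the ring of integers $\mathbb{Z}[\mu_n]$ of the cyclotomic field $\mathbb{Q}(\mu_n)$, let $\mathfrak{p}$ be the prime ideal generated by $p$ and $f(\mu_n)$; then $\mathbb{Z}[\mu_n]/\mathfrak{p} \cong GF(q)$, giving a ring homomorphism $\phi : \mathbb{Z}[\mu_n] \to GF(q)$ (reduction mod $\mathfrak{p}$) with $\phi(\mu_n) = \alpha$. The lift of an element of $GF(q)$ is defined by sending $0 \mapsto 0$ and $\alpha^j \mapsto \mu_n^j$ for $j = 0, \ldots, q-2$, so lifted symbols lie in the alphabet $\bar{\mathcal{A}} = \{0\} \cup \{\mu_n^j\}$ of size $q$. Given an $M_t$-dimensional subspace $\Pi$ of $GF(q)^m$ with a chosen $M_t \times m$ generator matrix, its lift $\bar{\Pi}$ is the subspace of $\mathbb{C}^m$ generated by the matrix obtained by lifting each entry of that generator matrix; $\bar{\Pi}$ is again $M_t$-dimensional. Two subspaces are called nonintersecting if their intersection is only the zero vector. *)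

theory Defs
  imports "HOL-Analysis.Analysis" "Berlekamp_Zassenhaus.Finite_Field"
begin

text \<open>
  Throughout, \<open>'p mod_ring\<close> with \<open>'p :: prime_card\<close> is GF(p), and a type
  \<open>'a :: {field,finite}\<close> is GF(q), so that q = \<open>CARD('a)\<close>.
\<close>

text \<open>The inclusion of GF(p) in GF(q). It is a ring homomorphism only if \<open>'a\<close> has characteristic
  \<open>CARD('p)\<close>, for example if \<open>CARD('a)\<close> is a power of \<open>CARD('p)\<close>.\<close>

definition gf_embed :: "'p::prime_card mod_ring \<Rightarrow> 'a::field" where
  "gf_embed c = of_int (to_int_mod_ring c)"

definition gf_root :: "'p::prime_card mod_ring poly \<Rightarrow> 'a::field \<Rightarrow> bool" where
  "gf_root f a \<longleftrightarrow> poly (map_poly gf_embed f) a = 0"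

definition primitive_element :: "'a::{field,finite} \<Rightarrow> bool" where
  "primitive_element a \<longleftrightarrow> UNIV - {0} = {a ^ j | j. j < CARD('a) - 1}"

text \<open>An irreducible polynomial over GF(p) of degree k is primitive if its roots in
  GF(q), where q = p^k, are primitive elements. Such a polynomial splits in GF(q), so the
  universal quantifier is not vacuous. The type argument names GF(q).\<close>

definition primitive_irreducible_poly ::
    "'a::{field,finite} itself \<Rightarrow> 'p::prime_card mod_ring poly \<Rightarrow> bool" where
  "primitive_irreducible_poly _ f \<longleftrightarrow>
     irreducible f \<and> CARD('a) = CARD('p) ^ degree f \<and>
     (\<forall>b::'a. gf_root f b \<longrightarrow> primitive_element b)"

definition mu :: "nat \<Rightarrow> complex" where
  "mu n = exp (2 * of_real pi * \<i> / of_nat n)"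

text \<open>The exponent is well defined if \<open>\<alpha>\<close> is a primitive element; the lift depends on \<open>\<alpha>\<close>.\<close>

definition lift_elem :: "'a::{field,finite} \<Rightarrow> 'a \<Rightarrow> complex" where
  "lift_elem \<alpha> x =
     (if x = 0 then 0
      else mu (CARD('a) - 1) ^ (THE j. j < CARD('a) - 1 \<and> \<alpha> ^ j = x))"

definition lift_matrix :: "'a::{field,finite} \<Rightarrow> 'a^'m^'t \<Rightarrow> complex^'m^'t" where
  "lift_matrix \<alpha> G = (\<chi> i j. lift_elem \<alpha> (G $ i $ j))"

text \<open>The \<open>vec\<close> operations are those of the vector space over the entry field; in particular
  \<open>vec.span\<close> below is the complex span. The rows of a generator matrix are
  a basis as soon as the subspace has dimension \<open>CARD('t)\<close>.\<close>

definition generator_matrix :: "'b::field^'m^'t \<Rightarrow> ('b^'m) set \<Rightarrow> bool" where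
  "generator_matrix G V \<longleftrightarrow> vec.span (rows G) = V"

text \<open>The lift of a subspace depends on the chosen generator matrix, so it is a function of the
  matrix.\<close>

definition lift_subspace :: "'a::{field,finite} \<Rightarrow> 'a^'m^'t \<Rightarrow> (complex^'m) set" where
  "lift_subspace \<alpha> G = vec.span (rows (lift_matrix \<alpha> G))"

end

theory Submission
  imports Defs
begin

text \<open>Reduction \<open>\<int>[\<mu>] \<rightarrow> GF(q)\<close> is handled through integer polynomials: if \<open>P(\<mu>) = 0\<close> then \<open>P(\<alpha>) = 0\<close>.
  By Dedekind's argument (irreducibility of the cyclotomic polynomials), \<open>P\<close> vanishes at all
  primitive \<open>n\<close>-th roots of unity, so \<open>X^n - 1\<close> divides \<open>P\<close> times the product of the \<open>X^d - 1\<close> for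
  \<open>0 < d < n\<close>, and none of the latter factors vanishes at \<open>\<alpha>\<close>.
  Two subspaces are nonintersecting iff the stack of their generator matrices (of full row rank)
  has a right inverse.
  Lifting a right inverse over GF(q) entrywise gives a square product matrix whose determinant
  reduces to \<open>1\<close>, hence is nonzero over \<open>\<complex>\<close>, and so the lifted stack has a right inverse, too.\<close>

section \<open>Evaluation of integer polynomials at ring elements\<close>

definition int_eval :: "'a::comm_ring_1 \<Rightarrow> int poly \<Rightarrow> 'a" where
  "int_eval z P = poly (of_int_poly P) z"

interpretation int_eval: comm_ring_hom "int_eval z"
  by unfold_locales (simp_all add: int_eval_def hom_distribs)

lemma int_eval_monom [simp]: "int_eval z (Polynomial.monom c k) = of_int c * z ^ k"
  by (simp add: int_eval_def poly_monom map_poly_monom)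

lemma int_eval_const [simp]: "int_eval z [:c:] = of_int c"
  using int_eval_monom[of z c 0] by (simp only: monom_0) simp

lemma int_eval_smult [simp]: "int_eval z (Polynomial.smult c P) = of_int c * int_eval z P"
  by (simp add: int_eval_def hom_distribs)

lemma int_eval_pCons: "int_eval z (pCons a P) = of_int a + z * int_eval z P"
  by (simp add: int_eval_def of_int_hom.map_poly_pCons_hom)

lemma int_eval_pcompose_monom [simp]:
  "int_eval z (pcompose P (Polynomial.monom 1 r)) = int_eval (z ^ r) P"
  by (induction P) (simp_all add: pcompose_pCons int_eval.hom_add int_eval.hom_mult int_eval_pCons)

text \<open>\<open>m\<close> is the primitive part of a nonzero polynomial of least degree vanishing
  at \<open>z\<close>, or \<open>0\<close> if there is none. Z[X] is not a principal ideal domain,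
  so pseudo-division and Gauss's lemma take the place of division with remainder.\<close>

lemma int_poly_ideal_principal:
  fixes z :: "'a::{idom,ring_char_0}"
  shows "\<exists>m. \<forall>P. int_eval z P = 0 \<longleftrightarrow> m dvd P"
proof (cases "\<exists>P. P \<noteq> 0 \<and> int_eval z P = 0")
  case False
  then have "\<forall>P. int_eval z P = 0 \<longleftrightarrow> 0 dvd P"
    by (metis dvd_0_left_iff int_eval.hom_zero)
  then show ?thesis ..
next
  case True
  then obtain P0 where P0: "P0 \<noteq> 0" "int_eval z P0 = 0"
    and min: "\<And>P. P \<noteq> 0 \<Longrightarrow> int_eval z P = 0 \<Longrightarrow> degree P0 \<le> degree P"
    using exists_least_iff[of "\<lambda>d. \<exists>P. P \<noteq> 0 \<and> int_eval z P = 0 \<and> degree P = d"]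
    by (metis not_le)
  define m where "m = primitive_part P0"
  have m: "content m = 1" "m \<noteq> 0" "degree m = degree P0"
    using P0(1) by (auto simp: m_def)
  have "int_eval z (Polynomial.smult (content P0) m) = 0"
    using P0(2) by (simp only: m_def content_times_primitive_part)
  then have mz: "int_eval z m = 0"
    using P0(1) by simp
  have "m dvd P" if P: "int_eval z P = 0" for P
  proof -
    obtain q s where qs: "pseudo_divmod P m = (q, s)"
      by (cases "pseudo_divmod P m")
    define c where "c = lead_coeff m ^ (Suc (degree P) - degree m)"
    have eq: "Polynomial.smult c P = m * q + s" and s: "s = 0 \<or> degree s < degree m"
      using pseudo_divmod[OF m(2) qs] by (simp_all add: c_def)
    have "int_eval z s = int_eval z (Polynomial.smult c P) - int_eval z (m * q)"
      by (simp add: eq int_eval.hom_add)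
    also have "\<dots> = 0"
      using P mz by (simp add: int_eval.hom_mult)
    finally have "s = 0"
      using min[of s] s m(3) by force
    \<comment> \<open>Over the fraction field the nonzero scalar \<open>c\<close> cancels; as
      \<open>content m = 1\<close>, Gauss's lemma brings the divisibility back to integer
      polynomials.\<close>
    then have "fract_poly m dvd fract_poly (Polynomial.smult c P)"
      by (simp only: eq fract_poly_mult add_0_right dvd_triv_left)
    then have "fract_poly m dvd Polynomial.smult (to_fract c) (fract_poly P)"
      by (simp only: fract_poly_smult)
    moreover have "to_fract c \<noteq> 0"
      using m(2) by (simp add: c_def)
    ultimately have "fract_poly m dvd fract_poly P"
      by (rule dvd_smult_cancel)
    then show ?thesis
      using m(1) by (rule fract_poly_dvdD)
  qed
  moreover have "int_eval z P = 0" if "m dvd P" for P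
    using that mz by (auto simp: int_eval.hom_mult)
  ultimately show ?thesis
    by blast
qed

section \<open>The Frobenius map on Z[X] modulo a prime \<open>r\<close>; congruence is divisibility
  by \<open>[:int r:]\<close>\<close>

lemma const_prime_dvd_power_add:
  fixes a b :: "int poly"
  assumes "prime r"
  shows "[:int r:] dvd (a + b) ^ r - (a ^ r + b ^ r)"
proof -
  have r: "r > 0"
    using assms by (simp add: prime_gt_0_nat)
  have "(a + b) ^ r = (\<Sum>k\<le>r. of_nat (r choose k) * a ^ k * b ^ (r - k))"
    by (rule binomial_ring)
  also have "{..r} = insert 0 (insert r {0<..<r})"
    using r by auto
  also have "(\<Sum>k\<in>\<dots>. of_nat (r choose k) * a ^ k * b ^ (r - k)) =
      a ^ r + b ^ r + (\<Sum>k\<in>{0<..<r}. of_nat (r choose k) * a ^ k * b ^ (r - k))"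
    using r by simp
  finally have "(a + b) ^ r - (a ^ r + b ^ r) =
      (\<Sum>k\<in>{0<..<r}. of_nat (r choose k) * a ^ k * b ^ (r - k))"
    by simp
  moreover have "[:int r:] dvd of_nat (r choose k) * a ^ k * b ^ (r - k)" if "k \<in> {0<..<r}" for k
  proof -
    have "r dvd r choose k"
      using that r assms by (intro dvd_choose_prime) auto
    then have "[:int r:] dvd of_nat (r choose k)"
      by (auto simp: of_nat_poly)
    then show ?thesis
      by (simp add: mult.assoc)
  qed
  ultimately show ?thesis
    by (simp only: dvd_sum)
qed

lemma prime_dvd_int_power_diff:
  assumes "prime r"
  shows "int r dvd a ^ r - a"
proof -
  \<comment> \<open>Passing to the nonnegative residue makes Fermat's theorem for natural numbers
    applicable to every integer \<open>a\<close>.\<close>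
  have "[nat (a mod int r) ^ r = nat (a mod int r)] (mod r)"
  proof (cases "r dvd nat (a mod int r)")
    case True
    moreover from True have "r dvd nat (a mod int r) ^ r"
      using prime_gt_0_nat[OF assms] by (intro dvd_trans[OF True dvd_power]) simp
    ultimately show ?thesis
      unfolding cong_def by (simp only: dvd_imp_mod_0)
  next
    case False
    have "[nat (a mod int r) ^ (r - 1) * nat (a mod int r) = 1 * nat (a mod int r)] (mod r)"
      using fermat_theorem[OF assms False] by (rule cong_scalar_right)
    then show ?thesis
      using prime_gt_0_nat[OF assms] by (metis mult_1 power_minus_mult)
  qed
  then have "[int (nat (a mod int r)) ^ r = int (nat (a mod int r))] (mod int r)"
    unfolding cong_int_iff[symmetric] of_nat_power .
  then have "[(a mod int r) ^ r = a mod int r] (mod int r)"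
    using prime_gt_0_nat[OF assms] by simp
  then show ?thesis
    unfolding cong_def power_mod mod_mod_trivial mod_eq_dvd_iff .
qed

text \<open>Modulo \<open>r\<close>, taking \<open>r\<close>-th powers is additive and, by Fermat,
  fixes the coefficients; only the exponents of the variable get multiplied by
  \<open>r\<close>.\<close>

lemma const_prime_dvd_power_diff_pcompose:
  assumes "prime r"
  shows "[:int r:] dvd P ^ r - pcompose P (Polynomial.monom 1 r)"
proof (induction P)
  case 0
  then show ?case
    using prime_gt_0_nat[OF assms] by (simp add: power_0_left)
next
  case (pCons a P)
  let ?X = "Polynomial.monom 1 r :: int poly"
  have e: "pCons a P = [:a:] + Polynomial.monom 1 1 * P"
    by (simp add: monom_altdef)
  have "[:int r:] dvd
      ([:a:] + Polynomial.monom 1 1 * P) ^ r - ([:a:] ^ r + (Polynomial.monom 1 1 * P) ^ r)"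
    by (rule const_prime_dvd_power_add[OF assms])
  moreover have "[:int r:] dvd [:a:] ^ r - [:a:]"
    using prime_dvd_int_power_diff[OF assms, of a] by (simp add: poly_const_pow)
  moreover have "[:int r:] dvd ?X * (P ^ r - pcompose P ?X)"
    by (rule dvd_mult[OF pCons.IH])
  ultimately have "[:int r:] dvd
      (([:a:] + Polynomial.monom 1 1 * P) ^ r - ([:a:] ^ r + (Polynomial.monom 1 1 * P) ^ r)) +
      ([:a:] ^ r - [:a:]) + ?X * (P ^ r - pcompose P ?X)"
    by (intro dvd_add)
  also have "\<dots> = pCons a P ^ r - pcompose (pCons a P) ?X"
    unfolding e[symmetric] pcompose_pCons
    by (simp add: power_mult_distrib monom_power algebra_simps)
  finally show ?case .
qed

text \<open>The quotient of Z[X] by \<open>m\<close> is a free Z-module of positive rank, so a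
  nonunit \<open>r\<close> stays noninvertible there: the ideal (\<open>m\<close>, \<open>r\<close>)
  is proper.\<close>

lemma not_dvd_one_minus_smult:
  fixes m w :: "int poly"
  assumes "is_unit (lead_coeff m)" "degree m > 0" "\<not> is_unit r"
  shows "\<not> m dvd 1 - Polynomial.smult r w"
proof
  assume "m dvd 1 - Polynomial.smult r w"
  then obtain a where a: "1 - Polynomial.smult r w = m * a"
    by (elim dvdE)
  have m0: "m \<noteq> 0"
    using assms(2) by auto
  obtain q s where qs: "pseudo_divmod w m = (q, s)"
    by (cases "pseudo_divmod w m")
  define c where "c = lead_coeff m ^ (Suc (degree w) - degree m)"
  have eq: "Polynomial.smult c w = m * q + s" and s: "s = 0 \<or> degree s < degree m"
    using pseudo_divmod[OF m0 qs] by (simp_all add: c_def)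
  have c: "is_unit c"
    using assms(1) unfolding c_def is_unit_power_iff by blast
  have "m * Polynomial.smult c a = Polynomial.smult c (1 - Polynomial.smult r w)"
    by (simp add: a)
  also have "\<dots> = [:c:] - Polynomial.smult r (Polynomial.smult c w)"
    by (simp add: smult_diff_right mult.commute)
  also have "\<dots> = [:c:] - Polynomial.smult r s - m * Polynomial.smult r q"
    by (simp add: eq smult_add_right)
  finally have e: "m * (Polynomial.smult c a + Polynomial.smult r q) = [:c:] - Polynomial.smult r s"
    by (simp add: algebra_simps)
  \<comment> \<open>A multiple of \<open>m\<close> of degree below \<open>degree m\<close> is zero,
    so both sides of \<open>e\<close> vanish. The constant coefficient then shows that
    \<open>r\<close> divides the unit \<open>c\<close>.\<close>
  have "degree ([:c:] - Polynomial.smult r s) < degree m"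
    using s assms(2) by (intro degree_diff_less) auto
  then have "Polynomial.smult c a + Polynomial.smult r q = 0"
    using m0 by (metis e degree_mult_right_le not_le)
  then have "[:c:] = Polynomial.smult r s"
    using e by simp
  then have "c = r * Polynomial.coeff s 0"
    by (metis coeff_pCons_0 coeff_smult)
  then show False
    using c assms(3) by (metis dvd_trans dvd_triv_left)
qed

section \<open>Dedekind's argument: passing from a root of unity to its powers with coprime
  exponent\<close>

lemma degree_monom_minus_one:
  "n > 0 \<Longrightarrow> degree (Polynomial.monom 1 n - 1 :: 'a::comm_ring_1 poly) = n"
  unfolding diff_conv_add_uminus
  by (subst degree_add_eq_left) (simp_all add: degree_monom_eq)

text \<open>Let X^n - 1 = \<open>m * g\<close> with \<open>m\<close> generating the relations of
  \<open>z\<close>. If \<open>z ^ r\<close> is not a root of \<open>m\<close>, it is one of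
  \<open>g\<close>, so \<open>m\<close> divides g(X^r), which is g^r modulo \<open>r\<close>. This
  would make \<open>m\<close> and X^n - 1 over \<open>m\<close> share a factor modulo
  \<open>r\<close>, although X^n - 1 is separable there because \<open>r\<close> does not divide
  \<open>n\<close>.\<close>

lemma int_eval_power_prime_root:
  fixes z :: "'a::{idom,ring_char_0}"
  assumes z: "z ^ n = 1" and n: "n > 0" and r: "prime r" "\<not> r dvd n"
    and P: "int_eval z P = 0"
  shows "int_eval (z ^ r) P = 0"
proof -
  obtain m where m: "\<And>P. int_eval z P = 0 \<longleftrightarrow> m dvd P"
    using int_poly_ideal_principal[of z] by blast
  define U where "U = (Polynomial.monom 1 n - 1 :: int poly)"
  have degU: "degree U = n"
    unfolding U_def using n by (rule degree_monom_minus_one)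
  then have leadU: "lead_coeff U = 1"
    using n by (simp add: U_def)
  have "m dvd U"
    unfolding m[symmetric] using z by (simp add: U_def int_eval.hom_minus)
  then obtain g where g: "U = m * g"
    by (elim dvdE)
  have lead: "is_unit (lead_coeff m)"
    using leadU unfolding g lead_coeff_mult by (metis dvd_triv_left)
  \<comment> \<open>A constant \<open>m\<close> would vanish at \<open>z\<close>, as a multiple of
    itself, hence be zero in characteristic 0, against \<open>lead\<close>.\<close>
  have deg: "degree m > 0"
  proof (rule ccontr)
    assume "\<not> degree m > 0"
    then obtain c where c: "m = [:c:]"
      by (metis degree_eq_zeroE gr0I)
    then have "of_int c = (0::'a)"
      using m[of m] by simp
    then show False
      using lead c by simp
  qed
  have "int_eval (z ^ r) m = 0"
  proof (rule ccontr)
    assume "int_eval (z ^ r) m \<noteq> 0"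
    moreover have "int_eval (z ^ r) (m * g) = 0"
      unfolding g[symmetric] U_def using z
      by (simp add: int_eval.hom_minus power_mult[symmetric] mult.commute[of r] power_mult[of z n])
    ultimately have "int_eval z (pcompose g (Polynomial.monom 1 r)) = 0"
      by (simp add: int_eval.hom_mult)
    then have mG: "m dvd pcompose g (Polynomial.monom 1 r)"
      unfolding m .
    obtain h where h: "g ^ r - pcompose g (Polynomial.monom 1 r) = [:int r:] * h"
      using const_prime_dvd_power_diff_pcompose[OF r(1), of g] by (elim dvdE)
    txt \<open>Since \<open>X U' = n + n m g\<close>, the integer \<open>n\<close> lies in the ideal \<open>(m, g)\<close>; as \<open>m\<close> divides \<open>g^r\<close>
      modulo \<open>r\<close>, the ideal \<open>(m, r)\<close> contains \<open>n^r\<close> and hence \<open>1\<close>.\<close>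
    define X where "X = (Polynomial.monom 1 1 :: int poly)"
    have "of_nat n * Polynomial.monom 1 n = X * pderiv U"
      using n by (simp add: U_def X_def pderiv_diff pderiv_monom mult_monom of_nat_poly smult_monom)
    moreover have "Polynomial.monom 1 n = U + 1"
      by (simp add: U_def)
    ultimately have "of_nat n = X * pderiv (m * g) - of_nat n * (m * g)"
      by (simp add: g algebra_simps)
    also have "\<dots> = m * (X * pderiv g - of_nat n * g) + g * (X * pderiv m)"
      by (simp add: pderiv_mult algebra_simps)
    finally have "of_nat n - g * (X * pderiv m) = m * (X * pderiv g - of_nat n * g)"
      by (simp only: add_diff_cancel_right')
    then have "m dvd of_nat n - g * (X * pderiv m)"
      by (rule dvdI)
    then have "m dvd of_nat n ^ r - (g * (X * pderiv m)) ^ r"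
      by (rule dvd_trans) (simp add: power_diff_sumr2)
    moreover define v where "v = (X * pderiv m) ^ r"
    ultimately have *: "m dvd of_nat n ^ r - g ^ r * v"
      by (simp add: power_mult_distrib)
    have "g ^ r = pcompose g (Polynomial.monom 1 r) + [:int r:] * h"
      using h by (simp add: algebra_simps)
    then have "of_nat n ^ r - [:int r:] * h * v =
        (of_nat n ^ r - g ^ r * v) + pcompose g (Polynomial.monom 1 r) * v"
      by (simp add: algebra_simps)
    then have **: "m dvd of_nat n ^ r - [:int r:] * h * v"
      using * mG by (metis dvd_add dvd_mult2)
    have "coprime r n"
      using r by (rule prime_imp_coprime)
    then have "coprime (int n ^ r) (int r)"
      by (simp add: coprime_commute)
    then obtain a b where ab: "a * int n ^ r + b * int r = 1"
      using bezout_int[of "int n ^ r" "int r"] by (auto simp: coprime_iff_gcd_eq_1)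
    have "[:a:] * of_nat n ^ r + [:b:] * [:int r:] = 1"
      using ab by (simp add: of_nat_poly poly_const_pow mult.commute)
    then have "[:a:] * (of_nat n ^ r - [:int r:] * h * v) = 1 - [:int r:] * ([:b:] + [:a:] * h * v)"
      by (simp only: algebra_simps flip: eq_diff_eq)
    then have "m dvd 1 - Polynomial.smult (int r) ([:b:] + [:a:] * h * v)"
      using ** by (metis dvd_mult mult_pCons_left mult_zero_left pCons_0_0 add_0_right)
    moreover have "\<not> is_unit (int r)"
      using r(1) by auto
    ultimately show False
      using not_dvd_one_minus_smult[OF lead deg] by blast
  qed
  moreover have "m dvd P"
    using P by (simp add: m)
  ultimately show ?thesis
    by (auto simp: int_eval.hom_mult elim!: dvdE)
qed

text \<open>The exponent is split into primes, none of which divides \<open>n\<close>, and the prime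
  case is applied to one after the other; every intermediate power is again an \<open>n\<close>-th
  root of unity.\<close>

lemma int_eval_power_coprime_root:
  fixes z :: "'a::{idom,ring_char_0}"
  assumes z: "z ^ n = 1" and n: "n > 0" and P: "int_eval z P = 0"
    and j: "coprime j n" "j > 0"
  shows "int_eval (z ^ j) P = 0"
  using j
proof (induction j rule: prime_divisors_induct)
  case zero
  then show ?case by simp
next
  case (unit j)
  then show ?case using P by simp
next
  case (factor r j)
  have "\<not> r dvd n"
    using factor.prems(1) factor.hyps by (auto simp: coprime_absorb_left)
  moreover have "int_eval (z ^ j) P = 0"
    using factor by auto
  moreover have "(z ^ j) ^ n = 1"
    using z by (metis mult.commute power_mult power_one)
  ultimately have "int_eval ((z ^ j) ^ r) P = 0"
    using int_eval_power_prime_root n factor.hyps by blast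
  then show ?case
    by (simp add: mult.commute flip: power_mult)
qed

section \<open>Complex roots of unity and the transfer of their integer relations\<close>

lemma mu_power: "mu n ^ j = exp (2 * of_real pi * \<i> * of_nat j / of_nat n)"
  by (simp add: mu_def field_simps flip: exp_of_nat_mult)

lemma mu_power_card: "n > 0 \<Longrightarrow> mu n ^ n = 1"
  by (simp add: mu_power)

text \<open>The range \<open>{1..n}\<close> instead of \<open>{0..<n}\<close> keeps exponents
  positive, as \<open>int_eval_power_coprime_root\<close> requires.\<close>

lemma inj_on_mu_power: "n > 0 \<Longrightarrow> inj_on (\<lambda>j. mu n ^ j) {1..n}"
proof (rule inj_onI)
  fix i j
  assume n: "n > 0" and ij: "i \<in> {1..n}" "j \<in> {1..n}" and "mu n ^ i = mu n ^ j"
  then have "i mod n = j mod n"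
    by (simp add: mu_power complex_root_unity_eq)
  then show "i = j"
    using ij by (cases "i = n"; cases "j = n") auto
qed

lemma int_poly_zero_if_many_zeros:
  fixes s :: "int poly" and A :: "'a::{idom,ring_char_0} set"
  assumes "\<And>x. x \<in> A \<Longrightarrow> int_eval x s = 0" and "degree s < card A"
  shows "s = 0"
proof -
  have "(of_int_poly s :: 'a poly) = 0"
    using assms by (intro poly_eqI_degree[where A = A]) (auto simp: int_eval_def)
  then show ?thesis
    by simp
qed

text \<open>This is what makes P(\<mu>) \<mapsto> P(a) a well-defined map on Z[\<mu>]. The domain
  containing \<open>a\<close> may have any characteristic.\<close>

lemma int_eval_eq_0_of_mu:
  fixes a :: "'a::idom"
  assumes n: "n > 0" and a: "a ^ n = 1" "\<And>d. 0 < d \<Longrightarrow> d < n \<Longrightarrow> a ^ d \<noteq> 1"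
    and P: "int_eval (mu n) P = 0"
  shows "int_eval a P = 0"
proof -
  define U where "U d = (Polynomial.monom 1 d - 1 :: int poly)" for d
  have U: "int_eval x (U d) = x ^ d - 1" for x :: "'b::comm_ring_1" and d
    by (simp add: U_def int_eval.hom_minus)
  define Q where "Q = P * (\<Prod>d\<in>{0<..<n}. U d)"
  have Q: "int_eval x Q = int_eval x P * (\<Prod>d\<in>{0<..<n}. x ^ d - 1)" for x :: "'b::comm_ring_1"
    by (simp add: Q_def int_eval.hom_mult int_eval.hom_prod U)
  have roots: "int_eval (mu n ^ j) Q = 0" if j: "j \<in> {1..n}" for j
  proof (cases "coprime j n")
    case True
    then show ?thesis
      using int_eval_power_coprime_root[OF mu_power_card[OF n] n P True] j by (simp add: Q)
  next
    case False
    \<comment> \<open>\<open>d\<close> is the order of \<open>mu n ^ j\<close>; it is below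
      \<open>n\<close> here, so the factor \<open>U d\<close> of \<open>Q\<close> vanishes at
      \<open>mu n ^ j\<close>.\<close>
    define d where "d = n div gcd j n"
    have "gcd j n > 1"
      using False n by (metis coprime_iff_gcd_eq_1 gcd_pos_nat less_one nat_neq_iff not_gr_zero)
    then have d: "d \<in> {0<..<n}"
      using n by (auto simp: d_def div_greater_zero_iff gcd_le2_nat)
    have "n dvd j * d"
      unfolding d_def by (metis div_mult_swap dvd_div_mult dvd_triv_right gcd_dvd1 gcd_dvd2)
    then have "(mu n ^ j) ^ d = 1"
      using mu_power_card[OF n] by (metis dvdE power_mult power_one)
    then show ?thesis
      unfolding Q using d by (auto intro!: bexI[of _ d] simp: prod_zero_iff)
  qed
  have degU: "degree (U n) = n"
    unfolding U_def using n by (rule degree_monom_minus_one)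
  then have "lead_coeff (U n) = 1"
    using n by (simp add: U_def)
  moreover obtain q s where qs: "pseudo_divmod Q (U n) = (q, s)"
    by (cases "pseudo_divmod Q (U n)")
  moreover have U0: "U n \<noteq> 0"
    using degU n by auto
  \<comment> \<open>The divisor \<open>U n\<close> is monic, so the scalar of the pseudo-division is
    \<open>1\<close>.\<close>
  ultimately have eq: "Q = U n * q + s" and s: "degree s < n"
    using pseudo_divmod[OF U0 qs] degU n by auto
  have "s = 0"
  proof (rule int_poly_zero_if_many_zeros)
    show "int_eval x s = 0" if x: "x \<in> (\<lambda>j. mu n ^ j) ` {1..n}" for x
    proof -
      obtain j where j: "x = mu n ^ j" "j \<in> {1..n}"
        using x by blast
      have "x ^ n = 1"
        unfolding j power_mult[symmetric] using mu_power_card[OF n]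
        by (simp add: mult.commute[of j] power_mult)
      then show ?thesis
        using roots[OF j(2)] unfolding j(1)[symmetric] eq
        by (simp add: int_eval.hom_add int_eval.hom_mult U)
    qed
    show "degree s < card ((\<lambda>j. mu n ^ j) ` {1..n})"
      using s by (subst card_image[OF inj_on_mu_power[OF n]]) simp
  qed
  then have "int_eval a Q = 0"
    using a(1) by (simp add: eq int_eval.hom_mult U)
  then show ?thesis
    using a(2) by (auto simp: Q)
qed

section \<open>Determinants under ring homomorphisms, and lifts of single field elements\<close>

lemma (in comm_ring_hom) hom_det_vec: "hom (det A) = det (\<chi> i j. hom (A $ i $ j))"
  by (simp add: det_def hom_sum hom_mult hom_prod hom_of_int)

text \<open>In GF(2) the element \<open>0\<close> also satisfies \<^const>\<open>primitive_element\<close>, because \<open>0 ^ 0 = 1\<close>; the lift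
  is then the same as for \<open>1\<close>, which is why \<open>\<beta>\<close> may differ from \<open>\<alpha>\<close>.\<close>

lemma lift_elem_primitive_root:
  fixes \<alpha> :: "'a::{field,finite}"
  defines "n \<equiv> CARD('a) - 1"
  assumes "primitive_element \<alpha>"
  obtains \<beta> :: 'a where "n > 0" "\<beta> ^ n = 1" "\<And>d. 0 < d \<Longrightarrow> d < n \<Longrightarrow> \<beta> ^ d \<noteq> 1"
    "\<And>x. x \<noteq> 0 \<Longrightarrow> \<exists>j. \<beta> ^ j = x \<and> lift_elem \<alpha> x = mu n ^ j"
proof -
  have im: "UNIV - {0} = (\<lambda>j. \<alpha> ^ j) ` {..<n}"
    using assms by (auto simp: primitive_element_def)
  have card: "card (UNIV - {0 :: 'a}) = n"
    by (simp add: n_def card_Diff_singleton)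
  \<comment> \<open>The \<open>n\<close> exponents reach all \<open>n\<close> nonzero elements, so
    no power is repeated.\<close>
  have inj: "inj_on (\<lambda>j. \<alpha> ^ j) {..<n}"
    by (rule eq_card_imp_inj_on) (simp_all flip: im add: card)
  have "card {0, 1 :: 'a} \<le> CARD('a)"
    by (rule card_mono) auto
  then have n: "n > 0"
    by (simp add: n_def)
  have ne: "\<alpha> ^ d \<noteq> 1" if "0 < d" "d < n" for d
    using inj_onD[OF inj, of d 0] that by auto
  have lift: "\<exists>j<n. \<alpha> ^ j = x \<and> lift_elem \<alpha> x = mu n ^ j" if "x \<noteq> 0" for x
  proof -
    have "x \<in> (\<lambda>j. \<alpha> ^ j) ` {..<n}"
      using that by (simp flip: im)
    then obtain j where j: "j < n" "\<alpha> ^ j = x"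
      by auto
    then have "(THE j. j < CARD('a) - 1 \<and> \<alpha> ^ j = x) = j"
      using inj unfolding n_def by (intro the_equality) (auto simp: inj_on_def)
    then show ?thesis
      using j that by (auto simp: lift_elem_def n_def)
  qed
  show ?thesis
  proof (cases "n = 1")
    \<comment> \<open>This is GF(2), where \<open>1\<close> is the only nonzero element.\<close>
    case True
    have "\<exists>j. 1 ^ j = x \<and> lift_elem \<alpha> x = mu n ^ j" if "x \<noteq> 0" for x
      using lift[OF that] True by (metis less_one power_0)
    then show ?thesis
      using True by (intro that[of 1]) simp_all
  next
    case False
    then have "\<alpha> ^ 1 \<in> UNIV - {0}"
      unfolding im using n by (intro imageI) simp
    then have "\<alpha> \<noteq> 0"
      by simp
    then have "\<alpha> ^ n \<noteq> 0"
      by simp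
    \<comment> \<open>The power \<alpha>^n is nonzero, so it already occurs with an exponent
      \<open>j < n\<close>; cancelling gives \<alpha>^(n-j) = 1, and \<open>ne\<close> leaves only
      \<open>j = 0\<close>.\<close>
    then obtain j where j: "j < n" "\<alpha> ^ j = \<alpha> ^ n"
      using lift by blast
    then have "\<alpha> ^ j * \<alpha> ^ (n - j) = \<alpha> ^ j * 1"
      by (metis le_add_diff_inverse less_imp_le mult_1_right power_add)
    then have "\<alpha> ^ (n - j) = 1"
      using \<open>\<alpha> \<noteq> 0\<close> by simp
    then have "j = 0"
      using ne[of "n - j"] j by force
    then have "\<alpha> ^ n = 1"
      using j(2) by (metis power_0)
    have "\<exists>j. \<alpha> ^ j = x \<and> lift_elem \<alpha> x = mu n ^ j" if "x \<noteq> 0" for x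
      using lift[OF that] by blast
    with n \<open>\<alpha> ^ n = 1\<close> ne show ?thesis
      by (rule that)
  qed
qed

section \<open>Row spans and independent rows. Coefficients are indexed by row numbers, since the
  set \<open>rows A\<close> merges equal rows\<close>

lemma mem_span_rows_iff:
  fixes A :: "'a::field^'m^'s"
  shows "x \<in> vec.span (rows A) \<longleftrightarrow> (\<exists>c. x = (\<Sum>i\<in>UNIV. c i *s row i A))"
proof
  let ?S = "range (\<lambda>c. \<Sum>i\<in>UNIV. c i *s row i A)"
  have "vec.span (rows A) \<subseteq> ?S"
  proof (rule vec.span_minimal)
    show "rows A \<subseteq> ?S"
    proof
      fix y assume "y \<in> rows A"
      then obtain k where "y = row k A"
        by (auto simp: rows_def)
      then have "y = (\<Sum>i\<in>UNIV. (if i = k then 1 else 0) *s row i A)"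
        by (simp add: if_distrib[of "\<lambda>c. c *s _"] cong: if_cong)
      then show "y \<in> ?S"
        by (rule range_eqI[of _ _ "\<lambda>i. if i = k then 1 else 0"])
    qed
    show "vec.subspace ?S"
    proof (rule vec.subspaceI)
      show "0 \<in> ?S"
        by (rule range_eqI[of _ _ "\<lambda>_. 0"]) simp
    next
      fix x y assume "x \<in> ?S" "y \<in> ?S"
      then obtain c d where "x = (\<Sum>i\<in>UNIV. c i *s row i A)" "y = (\<Sum>i\<in>UNIV. d i *s row i A)"
        by blast
      then have "x + y = (\<Sum>i\<in>UNIV. (c i + d i) *s row i A)"
        by (simp add: vec.scale_left_distrib sum.distrib)
      then show "x + y \<in> ?S"
        by (rule range_eqI[of _ _ "\<lambda>i. c i + d i"])
    next
      fix k x assume "x \<in> ?S"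
      then obtain c where "x = (\<Sum>i\<in>UNIV. c i *s row i A)"
        by blast
      then have "k *s x = (\<Sum>i\<in>UNIV. (k * c i) *s row i A)"
        by (simp add: vec.scale_sum_right)
      then show "k *s x \<in> ?S"
        by (rule range_eqI[of _ _ "\<lambda>i. k * c i"])
    qed
  qed
  then show "x \<in> vec.span (rows A) \<Longrightarrow> \<exists>c. x = (\<Sum>i\<in>UNIV. c i *s row i A)"
    by blast
next
  assume "\<exists>c. x = (\<Sum>i\<in>UNIV. c i *s row i A)"
  then show "x \<in> vec.span (rows A)"
    by (auto simp: rows_def intro!: vec.span_sum vec.span_scale intro: vec.span_base)
qed

text \<open>A spanning set has at least as many elements as the dimension, so the rows are pairwise
  distinct and form a spanning set of minimal size, which is independent.\<close>

lemma rows_independent_if_dim: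
  fixes A :: "'a::field^'m^'s"
  assumes dim: "vec.dim (vec.span (rows A)) = CARD('s)" and c: "(\<Sum>i\<in>UNIV. c i *s row i A) = 0"
  shows "c i = 0"
proof -
  have rows: "rows A = range (\<lambda>i. row i A)"
    by (auto simp: rows_def)
  have "CARD('s) \<le> card (rows A)"
    unfolding dim[symmetric] by (rule vec.dim_le_card) (simp_all add: rows)
  moreover have "card (rows A) \<le> CARD('s)"
    unfolding rows by (rule card_image_le) simp
  ultimately have card: "card (rows A) = CARD('s)"
    by simp
  then have inj: "inj (\<lambda>i. row i A)"
    unfolding rows by (intro eq_card_imp_inj_on) simp_all
  have indep: "vec.independent (rows A)"
    by (rule vec.card_le_dim_spanning[of _ "vec.span (rows A)"])
       (simp_all only: vec.span_superset dim card le_refl, simp_all add: rows)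
  have "(\<Sum>v\<in>rows A. c (inv_into UNIV (\<lambda>i. row i A) v) *s v) = 0"
    unfolding rows using c by (simp add: sum.reindex[OF inj] inv_into_f_f[OF inj] o_def)
  then have "c (inv_into UNIV (\<lambda>i. row i A) (row i A)) = 0"
    using indep by (intro vec.independentD[where s = "rows A" and t = "rows A"]) (auto simp: rows)
  then show ?thesis
    by (simp add: inv_into_f_f[OF inj])
qed

lemma lift_matrix_rows_independent:
  fixes A :: "'a::{field,finite}^'m^'s"
  assumes prim: "primitive_element \<alpha>"
    and indep: "\<And>c. (\<Sum>i\<in>UNIV. c i *s row i A) = 0 \<Longrightarrow> \<forall>i. c i = 0"
    and d: "(\<Sum>i\<in>UNIV. d i *s row i (lift_matrix \<alpha> A)) = 0"
  shows "d i = 0"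
proof -
  let ?n = "CARD('a) - 1"
  obtain \<beta> where n: "?n > 0" and \<beta>: "\<beta> ^ ?n = 1" "\<And>d. 0 < d \<Longrightarrow> d < ?n \<Longrightarrow> \<beta> ^ d \<noteq> 1"
    and lift: "\<And>x. x \<noteq> 0 \<Longrightarrow> \<exists>j. \<beta> ^ j = x \<and> lift_elem \<alpha> x = mu ?n ^ j"
    using lift_elem_primitive_root[OF prim] by blast
  have "\<exists>L. int_eval \<beta> L = x \<and> int_eval (mu ?n) L = lift_elem \<alpha> x" for x
  proof (cases "x = 0")
    case True
    then show ?thesis
      by (intro exI[of _ 0]) (simp add: lift_elem_def)
  next
    case False
    then obtain j where "\<beta> ^ j = x" "lift_elem \<alpha> x = mu ?n ^ j"
      using lift by blast
    then show ?thesis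
      by (intro exI[of _ "Polynomial.monom 1 j"]) simp
  qed
  \<comment> \<open>\<open>L x\<close> is one integer polynomial, zero or a power of X, that
    represents both \<open>x\<close> (at \<beta>) and its lift (at \<mu>).\<close>
  then have "\<exists>L. \<forall>x. int_eval \<beta> (L x) = x \<and> int_eval (mu ?n) (L x) = lift_elem \<alpha> x"
    by (intro choice allI)
  then obtain L where "\<forall>x. int_eval \<beta> (L x) = x \<and> int_eval (mu ?n) (L x) = lift_elem \<alpha> x" ..
  then have L: "int_eval \<beta> (L x) = x" "int_eval (mu ?n) (L x) = lift_elem \<alpha> x" for x
    by simp_all
  have "\<exists>B :: 'a^'s^'m. A ** B = mat 1"
    unfolding matrix_right_invertible_independent_rows using indep by (intro allI impI) (rule spec)
  then obtain B :: "'a^'s^'m" where B: "A ** B = mat 1" ..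
  \<comment> \<open>A determinant over Z[X]: at \<beta> it becomes \<open>det (A ** B)\<close>,
    which is \<open>1\<close>, and at \<mu> the determinant of the product of the lifted
    matrices.\<close>
  define D where "D = det (\<chi> i j. \<Sum>k\<in>UNIV. L (A $ i $ k) * L (B $ k $ j))"
  have "int_eval \<beta> D = det (A ** B)"
    by (simp add: D_def int_eval.hom_det_vec int_eval.hom_sum int_eval.hom_mult L matrix_matrix_mult_def)
  then have "int_eval \<beta> D \<noteq> 0"
    by (simp add: B)
  then have "int_eval (mu ?n) D \<noteq> 0"
    using int_eval_eq_0_of_mu[OF n \<beta>] by blast
  moreover have "int_eval (mu ?n) D = det (lift_matrix \<alpha> A ** lift_matrix \<alpha> B)"
    by (simp add: D_def int_eval.hom_det_vec int_eval.hom_sum int_eval.hom_mult L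
        matrix_matrix_mult_def lift_matrix_def del: One_nat_def)
  ultimately have "invertible (lift_matrix \<alpha> A ** lift_matrix \<alpha> B)"
    by (simp add: invertible_det_nz)
  then obtain C where "lift_matrix \<alpha> A ** lift_matrix \<alpha> B ** C = mat 1"
    by (auto simp: invertible_def)
  then have "\<exists>C. lift_matrix \<alpha> A ** C = mat 1"
    by (metis matrix_mul_assoc)
  then show ?thesis
    unfolding matrix_right_invertible_independent_rows using d by (elim allE[of _ d]) simp
qed

section \<open>Nonintersection through the stacked generator matrix\<close>

lemma sum_UNIV_Plus:
  fixes f :: "'s::finite + 't::finite \<Rightarrow> 'b::comm_monoid_add"
  shows "(\<Sum>i\<in>UNIV. f i) = (\<Sum>i\<in>UNIV. f (Inl i)) + (\<Sum>i\<in>UNIV. f (Inr i))"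
  unfolding UNIV_Plus_UNIV[symmetric] by (subst sum.Plus) simp_all

theorem theorem3p5:
  fixes k :: nat
    and f :: "'p::prime_card mod_ring poly"
    and \<alpha> :: "'a::{field,finite}"
    and V\<^sub>1 V\<^sub>2 :: "('a^'m) set"
    and G\<^sub>1 G\<^sub>2 :: "'a^'m^'t"
  assumes "CARD('a) = CARD('p) ^ k"
    and "primitive_irreducible_poly TYPE('a) f"
    and "gf_root f \<alpha>"
    and "vec.subspace V\<^sub>1" and "vec.dim V\<^sub>1 = CARD('t)" and "generator_matrix G\<^sub>1 V\<^sub>1"
    and "vec.subspace V\<^sub>2" and "vec.dim V\<^sub>2 = CARD('t)" and "generator_matrix G\<^sub>2 V\<^sub>2"
    and "V\<^sub>1 \<inter> V\<^sub>2 = {0}"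
  shows "lift_subspace \<alpha> G\<^sub>1 \<inter> lift_subspace \<alpha> G\<^sub>2 = {0}"
proof -
  have prim: "primitive_element \<alpha>"
    using assms(2,3) by (simp add: primitive_irreducible_poly_def)
  have V: "vec.span (rows G\<^sub>1) = V\<^sub>1" "vec.span (rows G\<^sub>2) = V\<^sub>2"
    using assms(6,9) by (simp_all add: generator_matrix_def)
  define stack :: "'a^'m^('t + 't)" where "stack = (\<chi> i. case_sum (($) G\<^sub>1) (($) G\<^sub>2) i)"
  have row_stack: "row (Inl i) stack = row i G\<^sub>1" "row (Inr i) stack = row i G\<^sub>2" for i
    by (simp_all add: stack_def row_def)
  have row_lift: "row (Inl i) (lift_matrix \<alpha> stack) = row i (lift_matrix \<alpha> G\<^sub>1)"
    "row (Inr i) (lift_matrix \<alpha> stack) = row i (lift_matrix \<alpha> G\<^sub>2)" for i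
    by (simp_all add: stack_def row_def lift_matrix_def)
  have indep: "\<forall>i. c i = 0" if c: "(\<Sum>i\<in>UNIV. c i *s row i stack) = 0" for c
  proof -
    \<comment> \<open>A relation among the stacked rows equates a combination of the first block
      with one of the second; the common value \<open>u\<close> lies in both subspaces.\<close>
    define u where "u = (\<Sum>i\<in>UNIV. c (Inl i) *s row i G\<^sub>1)"
    have u: "u = (\<Sum>i\<in>UNIV. - c (Inr i) *s row i G\<^sub>2)"
      using c by (simp add: u_def sum_UNIV_Plus row_stack vec.scale_minus_left sum_negf eq_neg_iff_add_eq_0)
    have "u \<in> V\<^sub>1"
      unfolding V[symmetric] mem_span_rows_iff u_def by (intro exI) (rule refl)
    moreover have "u \<in> V\<^sub>2"
      unfolding V[symmetric] mem_span_rows_iff u by (intro exI) (rule refl)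
    ultimately have "u = 0"
      using assms(10) by blast
    then have "c (Inl i) = 0" "- c (Inr i) = 0" for i
      using rows_independent_if_dim[of G\<^sub>1 "\<lambda>i. c (Inl i)" i] assms(5)
        rows_independent_if_dim[of G\<^sub>2 "\<lambda>i. - c (Inr i)" i] assms(8)
      unfolding V u[symmetric] u_def[symmetric] by auto
    then show ?thesis
      by (metis neg_equal_0_iff_equal sum.exhaust)
  qed
  have "x = 0" if x: "x \<in> lift_subspace \<alpha> G\<^sub>1" "x \<in> lift_subspace \<alpha> G\<^sub>2" for x
  proof -
    obtain a b where a: "x = (\<Sum>i\<in>UNIV. a i *s row i (lift_matrix \<alpha> G\<^sub>1))"
      and b: "x = (\<Sum>i\<in>UNIV. b i *s row i (lift_matrix \<alpha> G\<^sub>2))"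
      using x unfolding lift_subspace_def mem_span_rows_iff by blast
    \<comment> \<open>Conversely, the two representations of a common vector \<open>x\<close> give a
      relation among the rows of the lifted stack.\<close>
    have "(\<Sum>i\<in>UNIV. case_sum a (\<lambda>i. - b i) i *s row i (lift_matrix \<alpha> stack)) = x - x"
      unfolding sum_UNIV_Plus row_lift sum.case vec.scale_minus_left sum_negf a[symmetric] b[symmetric]
      by simp
    then have "case_sum a (\<lambda>i. - b i) (Inl i) = 0" for i
      by (intro lift_matrix_rows_independent[OF prim indep]) simp_all
    then show ?thesis
      unfolding a by simp
  qed
  then show ?thesis
    by (auto simp: lift_subspace_def vec.span_zero)
qed

end
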